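(* Let $\mathcal{R}\subset\mathbb{R}^d$ be the hyperbolicity set of the flux $\mathbf{f}$, assumed open and convex. Let $\mathbf{U}(t_n,x_i)=(\mathbf{u}_0(t_n,x_i),\dots,\mathbf{u}_K(t_n,x_i))$, $i=0,\dots,I+1$, be the moment vectors at time step $t_n$ (the indices $i=0$ and $i=I+1$ denoting the boundary neighbour states), and suppose that $$\mathbf{U}(t_n,x_i)\in\mathcal{R}^Q \quad\text{for all } i,$$ that is, $\sum_{k=0}^K \mathbf{u}_k(t_n,x_i)\phi_k(\xi_q)\in\mathcal{R}$ for all $q=1,\dots,Q$ and all $i$. Let $$b:=\sup\Big\{\tilde b>0 \;\Big|\; \mathbf{u}\pm\tilde b\,\mathbf{f}(\mathbf{u})\in\mathcal{R}\ \text{ for every } \mathbf{u}=\sum_{k=0}^K\mathbf{u}_k(t_n,x_i)\phi_k(\xi_q),\ \text{all } i,\ q=1,\dots,Q\Big\},$$ and suppose that the time step $\Delta t>0$ satisfies $$\Delta t<\min\Big(b\,\Delta x,\ \frac{\Delta x}{\lambda_{\max}}\Big).$$ Then one time step of the Lax–Friedrichs scheme (given in the context) preserves hyperbolicity of the zeroth moment, i.e. $\mathbf{u}_0(t_{n+1},x_i)\in\mathcal{R}$ for all $i=1,\dots,I$.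
   Context: Setting: $\partial_t\mathbf{u}+\partial_x\mathbf{f}(\mathbf{u})=0$ is a system of conservation laws in one space dimension with flux $\mathbf{f}:\mathbb{R}^d\to\mathbb{R}^d$. The solution $\mathbf{u}(t,x,\xi)$ depends on a one-dimensional random variable $\xi$ with values in $\Gamma\subset\mathbb{R}$ and probability density $f_\Xi:\Gamma\to\mathbb{R}_+$. The hyperbolicity set is $\mathcal{R}:=\{\mathbf{u}\in\mathbb{R}^d : \text{all eigenvalues of } \partial\mathbf{f}(\mathbf{u})/\partial\mathbf{u} \text{ are real}\}$. It is always assumed to be open and convex. Stochastic Galerkin: $\phi_0,\dots,\phi_K$ are polynomials ($\phi_k$ of degree $k$), orthonormal with respect to $\langle g,h\rangle=\int_\Gamma g h f_\Xi\,d\xi$, with $\phi_0=1$. The solution is approximated by $\sum_{k=0}^K\mathbf{u}_k(t,x)\phi_k(\xi)$ with moments $\mathbf{u}_k(t,x)\in\mathbb{R}^d$, and $\mathbf{U}=(\mathbf{u}_0,\dots,\mathbf{u}_K)\in\mathbb{R}^{d(K+1)}$. Quadrature: integrals $\int_\Gamma g(\xi)f_\Xi(\xi)\,d\xi$ are replaced by $\sum_{q=1}^Q g(\xi_q)f_\Xi(\xi_q)w_q$ with Gauss quadrature nodes $\xi_q\in\Gamma$ and weights $w_q>0$. The quadrature is treated as exact for the basis polynomials, so that $\sum_{q=1}^Q\phi_k(\xi_q)\phi_0(\xi_q)f_\Xi(\xi_q)w_q=\delta_{k0}$ for $k=0,\dots,K$. Stochastic numerical hyperbolicity set: $\mathcal{R}^Q:=\{\mathbf{U}\in\mathbb{R}^{d(K+1)}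 : \sum_{k=0}^K\mathbf{u}_k\phi_k(\xi_q)\in\mathcal{R}\ \ \forall q=1,\dots,Q\}$. Grid: the spatial interval $[x_L,x_R]$ is divided into $I$ cells of width $\Delta x=(x_R-x_L)/I$ with centers $x_1,\dots,x_I$. The states at $x_0$ and $x_{I+1}$ are boundary (ghost) states, e.g. given by periodicity. Lax–Friedrichs scheme: for $j=0,\dots,K$ and $i=1,\dots,I$, $$\mathbf{u}_j(t_{n+1},x_i)=\tfrac12\big(\mathbf{u}_j(t_n,x_{i+1})+\mathbf{u}_j(t_n,x_{i-1})\big)-\frac{\Delta t}{2\Delta x}\sum_{q=1}^Q\mathbf{f}\Big(\sum_{k=0}^K\mathbf{u}_k(t_n,x_{i+1})\phi_k(\xi_q)\Big)\phi_j(\xi_q)f_\Xi(\xi_q)w_q+\frac{\Delta t}{2\Delta x}\sum_{q=1}^Q\mathbf{f}\Big(\sum_{k=0}^K\mathbf{u}_k(t_n,x_{i-1})\phi_k(\xi_q)\Big)\phi_j(\xi_q)f_\Xi(\xi_q)w_q .$$ $\lambda_{\max}$ is the largest absolute value of the eigenvalues of the Jacobian $\partial\mathbf{F}/\partial\mathbf{U}$ of the stochastic Galerkin flux at the states of time $t_n$. This Jacobian is the block matrix with $d\times d$ blocks $\int_\Gamma\frac{\partial\mathbf{f}}{\partial\mathbf{u}}\big(\sum_k\mathbf{u}_k\phi_k\big)\phi_j\phi_i f_\Xi\,d\xi$, $i,j=0,\dots,K$. Conventions: $\Delta x/0=+\infty$, and $b$ may equal $+\infty$. *)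

theory Defs
  imports "HOL-Analysis.Analysis" "Jordan_Normal_Form.Spectral_Radius"
begin

text \<open>
  \<^const>\<open>vec_index\<close> and \<^const>\<open>vec_nth\<close> share the infix dollar sign;
  below it always means the latter.
\<close>
no_notation vec_index (infixl "$" 100)

text \<open>
  Spectra are taken over the complex numbers, through the matrices of \<^theory>\<open>Jordan_Normal_Form.Matrix\<close>.
  The index type \<open>'d\<close> is enumerated by \<open>from_nat_into UNIV\<close>, a bijection from
  \<open>{..<CARD('d)}\<close> to \<open>UNIV\<close>; another enumeration conjugates the matrix by a
  permutation and leaves its spectrum unchanged.
\<close>

definition complex_mat :: "real^'d^'d \<Rightarrow> complex mat" where
  "complex_mat A = Matrix.mat CARD('d) CARD('d)
     (\<lambda>(r, c). complex_of_real (A $ from_nat_into UNIV r $ from_nat_into UNIV c))"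

text \<open>
  The \<open>n * CARD('d)\<close>-dimensional matrix with blocks \<open>B i j\<close>, for \<open>i, j < n\<close>:
  row \<open>r\<close> is component \<open>r mod CARD('d)\<close> of block row \<open>r div CARD('d)\<close>.
\<close>
definition complex_block_mat :: "nat \<Rightarrow> (nat \<Rightarrow> nat \<Rightarrow> real^'d^'d) \<Rightarrow> complex mat" where
  "complex_block_mat n B = Matrix.mat (n * CARD('d)) (n * CARD('d))
     (\<lambda>(r, c). complex_of_real
        (B (r div CARD('d)) (c div CARD('d))
           $ from_nat_into UNIV (r mod CARD('d)) $ from_nat_into UNIV (c mod CARD('d))))"

definition hyperbolicity_set :: "(real^'d \<Rightarrow> real^'d) \<Rightarrow> (real^'d) set" where
  "hyperbolicity_set f = {u. spectrum (complex_mat (jacobian f (at u))) \<subseteq> \<real>}"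

text \<open>
  A moment vector \<open>U\<close> in dimension \<open>CARD('d) * (K + 1)\<close> is given by its blocks \<open>U k :: real^'d\<close>,
  \<open>k \<le> K\<close>; no definition below inspects \<open>U k\<close> for \<open>k > K\<close>.
\<close>
definition gpc_sum :: "(nat \<Rightarrow> real poly) \<Rightarrow> nat \<Rightarrow> (nat \<Rightarrow> real^'d) \<Rightarrow> real \<Rightarrow> real^'d" where
  "gpc_sum \<phi> K U \<xi> = (\<Sum>k\<le>K. poly (\<phi> k) \<xi> *\<^sub>R U k)"

definition stochastic_numerical_hyperbolicity_set ::
  "(real^'d \<Rightarrow> real^'d) \<Rightarrow> (nat \<Rightarrow> real poly) \<Rightarrow> nat \<Rightarrow> nat \<Rightarrow> (nat \<Rightarrow> real)
   \<Rightarrow> (nat \<Rightarrow> real^'d) set" where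
  "stochastic_numerical_hyperbolicity_set f \<phi> K Q \<xi> =
     {U. \<forall>q\<in>{1..Q}. gpc_sum \<phi> K U (\<xi> q) \<in> hyperbolicity_set f}"

definition probability_density_on :: "real set \<Rightarrow> (real \<Rightarrow> real) \<Rightarrow> bool" where
  "probability_density_on \<Gamma> \<rho> \<longleftrightarrow>
     \<Gamma> \<in> sets borel \<and> (\<forall>x\<in>\<Gamma>. 0 \<le> \<rho> x) \<and>
     set_integrable lborel \<Gamma> \<rho> \<and> (LINT x:\<Gamma>|lborel. \<rho> x) = 1"

definition orthonormal_basis ::
  "real set \<Rightarrow> (real \<Rightarrow> real) \<Rightarrow> (nat \<Rightarrow> real poly) \<Rightarrow> nat \<Rightarrow> bool" where
  "orthonormal_basis \<Gamma> \<rho> \<phi> K \<longleftrightarrow>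
     \<phi> 0 = 1 \<and> (\<forall>k\<le>K. degree (\<phi> k) = k) \<and>
     (\<forall>i\<le>K. \<forall>j\<le>K.
        set_integrable lborel \<Gamma> (\<lambda>x. poly (\<phi> i) x * poly (\<phi> j) x * \<rho> x) \<and>
        (LINT x:\<Gamma>|lborel. poly (\<phi> i) x * poly (\<phi> j) x * \<rho> x) = (if i = j then 1 else 0))"

definition sg_jacobian ::
  "(real^'d \<Rightarrow> real^'d) \<Rightarrow> real set \<Rightarrow> (real \<Rightarrow> real) \<Rightarrow> (nat \<Rightarrow> real poly) \<Rightarrow> nat
   \<Rightarrow> (nat \<Rightarrow> real^'d) \<Rightarrow> complex mat" where
  "sg_jacobian f \<Gamma> \<rho> \<phi> K U = complex_block_mat (K + 1)
     (\<lambda>i j. LINT x:\<Gamma>|lborel.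
        (poly (\<phi> j) x * poly (\<phi> i) x * \<rho> x) *\<^sub>R jacobian f (at (gpc_sum \<phi> K U x)))"

text \<open>
  \<open>U i\<close> is the moment vector in cell \<open>i\<close>; the indices \<open>0\<close> and \<open>I + 1\<close> are the ghost cells.
\<close>
definition lambda_max ::
  "(real^'d \<Rightarrow> real^'d) \<Rightarrow> real set \<Rightarrow> (real \<Rightarrow> real) \<Rightarrow> (nat \<Rightarrow> real poly) \<Rightarrow> nat
   \<Rightarrow> nat \<Rightarrow> (nat \<Rightarrow> nat \<Rightarrow> real^'d) \<Rightarrow> real" where
  "lambda_max f \<Gamma> \<rho> \<phi> K I U = (MAX i\<in>{0..I + 1}. spectral_radius (sg_jacobian f \<Gamma> \<rho> \<phi> K (U i)))"

text \<open>
  Taken in \<^typ>\<open>ereal\<close>, so that the supremum of an unbounded set is \<open>\<infinity>\<close>.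
\<close>
definition flux_bound ::
  "(real^'d \<Rightarrow> real^'d) \<Rightarrow> (nat \<Rightarrow> real poly) \<Rightarrow> nat \<Rightarrow> nat \<Rightarrow> (nat \<Rightarrow> real)
   \<Rightarrow> nat \<Rightarrow> (nat \<Rightarrow> nat \<Rightarrow> real^'d) \<Rightarrow> ereal" where
  "flux_bound f \<phi> K Q \<xi> I U = Sup (ereal ` {b. b > 0 \<and>
     (\<forall>i\<in>{0..I + 1}. \<forall>q\<in>{1..Q}. let u = gpc_sum \<phi> K (U i) (\<xi> q) in
        u + b *\<^sub>R f u \<in> hyperbolicity_set f \<and> u - b *\<^sub>R f u \<in> hyperbolicity_set f)})"

definition quadrature_flux ::
  "(real^'d \<Rightarrow> real^'d) \<Rightarrow> (real \<Rightarrow> real) \<Rightarrow> (nat \<Rightarrow> real poly) \<Rightarrow> nat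
   \<Rightarrow> nat \<Rightarrow> (nat \<Rightarrow> real) \<Rightarrow> (nat \<Rightarrow> real) \<Rightarrow> (nat \<Rightarrow> real^'d) \<Rightarrow> nat \<Rightarrow> real^'d" where
  "quadrature_flux f \<rho> \<phi> K Q \<xi> w U j =
     (\<Sum>q=1..Q. (poly (\<phi> j) (\<xi> q) * \<rho> (\<xi> q) * w q) *\<^sub>R f (gpc_sum \<phi> K U (\<xi> q)))"

definition lax_friedrichs_step ::
  "(real^'d \<Rightarrow> real^'d) \<Rightarrow> (real \<Rightarrow> real) \<Rightarrow> (nat \<Rightarrow> real poly) \<Rightarrow> nat
   \<Rightarrow> nat \<Rightarrow> (nat \<Rightarrow> real) \<Rightarrow> (nat \<Rightarrow> real) \<Rightarrow> real \<Rightarrow> real \<Rightarrow> nat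
   \<Rightarrow> (nat \<Rightarrow> nat \<Rightarrow> real^'d) \<Rightarrow> (nat \<Rightarrow> nat \<Rightarrow> real^'d) \<Rightarrow> bool" where
  "lax_friedrichs_step f \<rho> \<phi> K Q \<xi> w \<Delta>t \<Delta>x I U U' \<longleftrightarrow>
     (\<forall>i\<in>{1..I}. \<forall>j\<le>K.
        U' i j = (1 / 2) *\<^sub>R (U (i + 1) j + U (i - 1) j)
          - (\<Delta>t / (2 * \<Delta>x)) *\<^sub>R quadrature_flux f \<rho> \<phi> K Q \<xi> w (U (i + 1)) j
          + (\<Delta>t / (2 * \<Delta>x)) *\<^sub>R quadrature_flux f \<rho> \<phi> K Q \<xi> w (U (i - 1)) j)"

end

theory Submission
  imports Defs
begin

text \<open>
  With weights \<open>c q = \<rho> (\<xi> q) * w q\<close>, which are nonnegative and sum to one, exactness of the quadrature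
  recovers the zeroth moment of each cell as the convex combination of its nodal values \<open>v q\<close>.
  Hence the scheme for \<open>j = 0\<close> is the mean, over the two neighbours, of convex combinations of
  \<open>v q \<plusminus> (\<Delta>t / \<Delta>x) *\<^sub>R f (v q)\<close>, and each of these lies on the segment from \<open>v q\<close> to
  \<open>v q \<plusminus> b *\<^sub>R f (v q)\<close> for some admissible \<open>b > \<Delta>t / \<Delta>x\<close>.
\<close>

text \<open>For \<open>b > 0\<close> the point is the convex combination of \<open>u\<close> and
  \<open>u + b *\<^sub>R v\<close> with weight \<open>s / b\<close> on the latter;
  \<open>b = 0\<close> forces \<open>s = 0\<close>.\<close>

lemma convex_add_scaleR_shorter:
  fixes C :: "'a::real_vector set"
  assumes "convex C" "u \<in> C" "u + b *\<^sub>R v \<in> C" "0 \<le> s" "s \<le> b"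
  shows "u + s *\<^sub>R v \<in> C"
proof (cases "b = 0")
  case True
  with assms show ?thesis by simp
next
  case False
  with assms have b: "b > 0" by simp
  have "(1 - s / b) *\<^sub>R u + (s / b) *\<^sub>R (u + b *\<^sub>R v) \<in> C"
    using assms b by (intro convexD) auto
  moreover have "(1 - s / b) *\<^sub>R u + (s / b) *\<^sub>R (u + b *\<^sub>R v) = u + s *\<^sub>R v"
    using b by (simp add: algebra_simps)
  ultimately show ?thesis by simp
qed

lemma flux_bound_add_diff_mem:
  assumes convex: "convex (hyperbolicity_set f)"
    and states: "\<And>i. i \<in> {0..I + 1} \<Longrightarrow>
      U i \<in> stochastic_numerical_hyperbolicity_set f \<phi> K Q \<xi>"
    and s: "0 \<le> s" "ereal s < flux_bound f \<phi> K Q \<xi> I U"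
    and i: "i \<in> {0..I + 1}" and q: "q \<in> {1..Q}"
  defines "u \<equiv> gpc_sum \<phi> K (U i) (\<xi> q)"
  shows "u + s *\<^sub>R f u \<in> hyperbolicity_set f" "u - s *\<^sub>R f u \<in> hyperbolicity_set f"
proof -
  \<comment> \<open>A number strictly below a supremum lies below some member, whether or not the
    supremum is attained or finite. An empty set of admissible \<open>b\<close> would give
    \<open>-\<infinity>\<close>, which cannot exceed \<open>s\<close>.\<close>
  obtain b where b: "s < b"
    and R: "u + b *\<^sub>R f u \<in> hyperbolicity_set f" "u - b *\<^sub>R f u \<in> hyperbolicity_set f"
    using s i q unfolding flux_bound_def less_Sup_iff u_def by (auto simp: Let_def)
  have u: "u \<in> hyperbolicity_set f"
    using states[OF i] q unfolding stochastic_numerical_hyperbolicity_set_def u_def by auto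
  show "u + s *\<^sub>R f u \<in> hyperbolicity_set f"
    using convex_add_scaleR_shorter[OF convex u R(1)] s b by simp
  \<comment> \<open>The same segment argument, in direction \<open>- f u\<close>.\<close>
  show "u - s *\<^sub>R f u \<in> hyperbolicity_set f"
    using convex_add_scaleR_shorter[OF convex u, of b "- f u" s] R(2) s b by simp
qed

text \<open>Interchanging the two finite sums leaves the discrete means of the
  \<open>\<phi> k\<close> as coefficients of the moments, and these vanish except at
  \<open>k = 0\<close>.\<close>

lemma quadrature_gpc_sum:
  assumes "\<And>k. k \<le> K \<Longrightarrow> (\<Sum>q\<in>A. c q * poly (\<phi> k) (\<xi> q)) = (if k = 0 then 1 else 0)"
  shows "(\<Sum>q\<in>A. c q *\<^sub>R gpc_sum \<phi> K U (\<xi> q)) = U 0"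
proof -
  have "(\<Sum>q\<in>A. c q *\<^sub>R gpc_sum \<phi> K U (\<xi> q))
      = (\<Sum>k\<le>K. (\<Sum>q\<in>A. c q * poly (\<phi> k) (\<xi> q)) *\<^sub>R U k)"
    unfolding gpc_sum_def
    by (simp add: scaleR_sum_right scaleR_sum_left sum.swap[of _ A])
  also have "\<dots> = (\<Sum>k\<le>K. if k = 0 then U k else 0)"
    using assms by (intro sum.cong) auto
  also have "\<dots> = U 0" by simp
  finally show ?thesis .
qed

theorem theorem3p3:
  fixes f :: "real^'d \<Rightarrow> real^'d"
    and \<Gamma> :: "real set" and f\<^sub>\<Xi> :: "real \<Rightarrow> real"
    and \<phi> :: "nat \<Rightarrow> real poly" and K :: nat
    and Q :: nat and \<xi> w :: "nat \<Rightarrow> real"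
    and x\<^sub>L x\<^sub>R \<Delta>x \<Delta>t :: real and I :: nat
    and U U' :: "nat \<Rightarrow> nat \<Rightarrow> real^'d"
  assumes flux: "\<And>u. f differentiable (at u)"
    and open_R: "open (hyperbolicity_set f)"
    and convex_R: "convex (hyperbolicity_set f)"
    and density: "probability_density_on \<Gamma> f\<^sub>\<Xi>"
    and basis: "orthonormal_basis \<Gamma> f\<^sub>\<Xi> \<phi> K"
    and nodes: "\<And>q. q \<in> {1..Q} \<Longrightarrow> \<xi> q \<in> \<Gamma>"
    and weights: "\<And>q. q \<in> {1..Q} \<Longrightarrow> w q > 0"
    and exact: "\<And>k. k \<le> K \<Longrightarrow>
      (\<Sum>q=1..Q. poly (\<phi> k) (\<xi> q) * poly (\<phi> 0) (\<xi> q) * f\<^sub>\<Xi> (\<xi> q) * w q) = (if k = 0 then 1 else 0)"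
    and grid: "x\<^sub>L < x\<^sub>R" "I \<ge> 1" "\<Delta>x = (x\<^sub>R - x\<^sub>L) / real I"
    and states: "\<And>i. i \<in> {0..I + 1} \<Longrightarrow>
      U i \<in> stochastic_numerical_hyperbolicity_set f \<phi> K Q \<xi>"
    and time_step: "\<Delta>t > 0"
    and CFL: "ereal \<Delta>t < min (flux_bound f \<phi> K Q \<xi> I U * ereal \<Delta>x)
      (ereal \<Delta>x / ereal (lambda_max f \<Gamma> f\<^sub>\<Xi> \<phi> K I U))"
    and scheme: "lax_friedrichs_step f f\<^sub>\<Xi> \<phi> K Q \<xi> w \<Delta>t \<Delta>x I U U'"
  shows "\<forall>i\<in>{1..I}. U' i 0 \<in> hyperbolicity_set f"
proof
  fix i assume i: "i \<in> {1..I}"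
  let ?R = "hyperbolicity_set f"
  define c where "c q = f\<^sub>\<Xi> (\<xi> q) * w q" for q
  define s where "s = \<Delta>t / \<Delta>x"
  define v where "v l q = gpc_sum \<phi> K (U l) (\<xi> q)" for l q
  have \<phi>0: "\<phi> 0 = 1"
    using basis by (simp add: orthonormal_basis_def)
  have dx: "\<Delta>x > 0"
    using grid by simp
  have s0: "0 \<le> s"
    using dx time_step by (simp add: s_def)
  \<comment> \<open>A finite bound allows division by \<open>\<Delta>x > 0\<close>, the value
    \<open>\<infinity>\<close> is immediate, and \<open>-\<infinity>\<close> would contradict
    \<open>CFL\<close>.\<close>
  have s: "ereal s < flux_bound f \<phi> K Q \<xi> I U"
    using CFL dx
    by (cases "flux_bound f \<phi> K Q \<xi> I U") (auto simp: s_def field_simps)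
  \<comment> \<open>The density is known to be nonnegative only on \<open>\<Gamma>\<close>, hence
    the appeal to \<open>nodes\<close>.\<close>
  have c0: "0 \<le> c q" if "q \<in> {1..Q}" for q
    using density nodes[OF that] weights[OF that]
    by (simp add: c_def probability_density_on_def)
  have c\<phi>: "(\<Sum>q=1..Q. c q * poly (\<phi> k) (\<xi> q)) = (if k = 0 then 1 else 0)" if "k \<le> K" for k
    using exact[OF that] by (simp add: \<phi>0 c_def mult_ac)
  have c1: "(\<Sum>q=1..Q. c q) = 1"
    using c\<phi>[of 0] by (simp add: \<phi>0)
  have U0: "U l 0 = (\<Sum>q=1..Q. c q *\<^sub>R v l q)" for l
    unfolding v_def by (rule quadrature_gpc_sum[symmetric]) (rule c\<phi>)
  have F0: "quadrature_flux f f\<^sub>\<Xi> \<phi> K Q \<xi> w (U l) 0 = (\<Sum>q=1..Q. c q *\<^sub>R f (v l q))" for l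
    by (simp add: quadrature_flux_def \<phi>0 c_def v_def)
  \<comment> \<open>For \<open>i\<close> in \<open>{1..I}\<close> both neighbours have index in
    \<open>{0..I + 1}\<close>, the range over which \<open>flux_bound\<close> is taken, so ghost
    cells are covered.\<close>
  have minus: "U (i + 1) 0 - s *\<^sub>R (\<Sum>q=1..Q. c q *\<^sub>R f (v (i + 1) q)) \<in> ?R"
  proof -
    have "(\<Sum>q=1..Q. c q *\<^sub>R (v (i + 1) q - s *\<^sub>R f (v (i + 1) q))) \<in> ?R"
      using i unfolding v_def
      by (intro convex_sum convex_R c1 c0 flux_bound_add_diff_mem(2)[OF convex_R states s0 s]) auto
    then show ?thesis
      by (simp add: U0 scaleR_diff_right sum_subtractf scaleR_sum_right mult.commute)
  qed
  have plus: "U (i - 1) 0 + s *\<^sub>R (\<Sum>q=1..Q. c q *\<^sub>R f (v (i - 1) q)) \<in> ?R"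
  proof -
    have "(\<Sum>q=1..Q. c q *\<^sub>R (v (i - 1) q + s *\<^sub>R f (v (i - 1) q))) \<in> ?R"
      using i unfolding v_def
      by (intro convex_sum convex_R c1 c0 flux_bound_add_diff_mem(1)[OF convex_R states s0 s]) auto
    then show ?thesis
      by (simp add: U0 scaleR_add_right sum.distrib scaleR_sum_right mult.commute)
  qed
  \<comment> \<open>The flux terms carry the same factor \<open>1 / 2\<close> as the averaged
    states, so the update can be regrouped by neighbour.\<close>
  have "\<Delta>t / (2 * \<Delta>x) = (1 / 2) * s"
    by (simp add: s_def)
  with scheme i have "U' i 0 =
      (1 / 2) *\<^sub>R (U (i + 1) 0 - s *\<^sub>R (\<Sum>q=1..Q. c q *\<^sub>R f (v (i + 1) q))) +
      (1 / 2) *\<^sub>R (U (i - 1) 0 + s *\<^sub>R (\<Sum>q=1..Q. c q *\<^sub>R f (v (i - 1) q)))"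
    unfolding lax_friedrichs_step_def
    by (simp add: F0 scaleR_add_right scaleR_diff_right)
  with convexD[OF convex_R minus plus, of "1 / 2" "1 / 2"] show "U' i 0 \<in> ?R"
    by simp
qed

end
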